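(* For all integers $L\ge 0$ and all integers $a$, $$T_0(L,a)=\sum_{k=0}^L C_{L,k}(a)\genfrac{[}{]}{0pt}{}{2k}{k-a}\qquad\text{and}\qquad \genfrac{[}{]}{0pt}{}{2L}{L-a}=\sum_{k=0}^L C'_{L,k}(a)\,T_0(k,a),$$ where $$C_{L,k}(a)=(-1)^{L-k}q^{\binom{L-k}{2}+\frac12(a^2-L^2)}\genfrac{[}{]}{0pt}{}{L}{k},\qquad C'_{L,k}(a)=q^{\frac12(k^2-a^2)}\genfrac{[}{]}{0pt}{}{L}{k}.$$
   Context: $q$ is an indeterminate (with a formal square root $q^{1/2}$); identities are identities of rational functions in $q^{1/2}$. $(q)_0=1$ and $(q)_n=\prod_{j=1}^n(1-q^j)$ for $n\ge1$. The $q$-binomial coefficient is $\genfrac{[}{]}{0pt}{}{n}{a}=\frac{(q)_n}{(q)_a(q)_{n-a}}$ if $0\le a\le n$, and $0$ otherwise. $\binom{x}{2}=x(x-1)/2$. The $q$-trinomial coefficient $T_n(L,a)$ is $$T_n(L,a)=\sum_{\substack{r=0\\ L-a-r\text{ even}}}^{L-|a|}\frac{q^{\frac12 r(r-n)}(q)_L}{(q)_{\frac{L-a-r}{2}}(q)_{\frac{L+a-r}{2}}(q)_r}$$ (an empty sum, i.e. $L<|a|$, being $0$). *)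

theory Defs
  imports "HOL-Computational_Algebra.Computational_Algebra"
begin

text \<open>
  Identities between rational functions in \<open>q\<^sup>1\<^sup>/\<^sup>2\<close> are equations in the field of fractions
  of the polynomial ring over a field of characteristic zero (for instance the rationals or the
  complex numbers), whose polynomial variable is \<open>q\<^sup>1\<^sup>/\<^sup>2\<close>. For an integer \<open>m\<close>, the power
  \<open>q\<^sup>m\<^sup>/\<^sup>2\<close> is then \<open>qhalf powi m\<close>, also for negative or odd \<open>m\<close>.
\<close>

type_synonym 'k ratfun = "'k poly fract"

definition qhalf :: "'k::field_char_0 ratfun" where
  "qhalf = to_fract [:0, 1:]"

definition qind :: "'k::field_char_0 ratfun" where
  "qind = qhalf ^ 2"

definition qpoch :: "nat \<Rightarrow> 'k::field_char_0 ratfun" where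
  "qpoch n = (\<Prod>j=1..n. 1 - qind ^ j)"

definition qbinom :: "int \<Rightarrow> int \<Rightarrow> 'k::field_char_0 ratfun" where
  "qbinom n a =
     (if 0 \<le> a \<and> a \<le> n then qpoch (nat n) / (qpoch (nat a) * qpoch (nat (n - a))) else 0)"

text \<open>
  On the index set of the following sum, \<open>L - a - r\<close> and \<open>L + a - r\<close> are both even and
  non-negative, so that neither \<open>div\<close> nor \<open>nat\<close> truncates.
\<close>

definition qtrinom :: "int \<Rightarrow> nat \<Rightarrow> int \<Rightarrow> 'k::field_char_0 ratfun" where
  "qtrinom n L a =
     (\<Sum>r\<in>{r::nat. int r \<le> int L - \<bar>a\<bar> \<and> even (int L - a - int r)}.
        qhalf powi (int r * (int r - n)) * qpoch L /
        (qpoch (nat ((int L - a - int r) div 2)) * qpoch (nat ((int L + a - int r) div 2)) * qpoch r))"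

definition C_coeff :: "nat \<Rightarrow> nat \<Rightarrow> int \<Rightarrow> 'k::field_char_0 ratfun" where
  "C_coeff L k a =
     (-1) ^ (L - k) * (qind ^ ((L - k) choose 2) * qhalf powi (a ^ 2 - int L ^ 2)) *
     qbinom (int L) (int k)"

definition C'_coeff :: "nat \<Rightarrow> nat \<Rightarrow> int \<Rightarrow> 'k::field_char_0 ratfun" where
  "C'_coeff L k a = qhalf powi (int k ^ 2 - a ^ 2) * qbinom (int L) (int k)"

end

theory Submission
  imports Defs
begin

text \<open>
  By inversion of the relation \<open>f n = (\<Sum>k\<le>n. [n; k] g k)\<close> between sequences, the first identity
  follows from the second. For the second one, take \<open>a \<ge> 0\<close> by symmetry and parametrise the summation
  indices as \<open>k = m + s + a\<close> and \<open>r = m - s\<close>. The exponent of \<open>q\<close> becomes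
  \<open>s (s + a) + m (m + a)\<close>, and the double sum factors into two successive applications of the
  \<open>q\<close>-Vandermonde identity, first over \<open>s\<close> and then over \<open>m\<close>.
\<close>

section \<open>Gaussian binomials over a commutative ring\<close>

text \<open>The q-Pascal recursion avoids division, so the identities below follow by induction;
  \<open>gauss_binom_qind\<close> recovers the quotient of q-factorials.\<close>

fun gauss_binom :: "'a::comm_ring_1 \<Rightarrow> nat \<Rightarrow> nat \<Rightarrow> 'a" where
  "gauss_binom q n 0 = 1"
| "gauss_binom q 0 (Suc k) = 0"
| "gauss_binom q (Suc n) (Suc k) = gauss_binom q n k + q ^ Suc k * gauss_binom q n (Suc k)"

lemma gauss_binom_eq_0: "n < k \<Longrightarrow> gauss_binom q n k = 0"
  by (induction q n k rule: gauss_binom.induct) auto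

lemma gauss_binom_self [simp]: "gauss_binom q n n = 1"
  by (induction n) (auto simp: gauss_binom_eq_0)

text \<open>The subtraction may truncate only where \<open>gauss_binom q n k\<close> vanishes.\<close>

lemma gauss_binom_Suc_Suc':
  "gauss_binom q (Suc n) (Suc k) = gauss_binom q n (Suc k) + q ^ (n - k) * gauss_binom q n k"
proof (induction n arbitrary: k)
  case 0
  then show ?case by (cases k) auto
next
  case (Suc n)
  show ?case
  proof (cases k)
    case 0
    then show ?thesis using Suc.IH[of 0] by (simp add: algebra_simps)
  next
    case (Suc j)
    show ?thesis
    \<comment> \<open>For \<open>j < n\<close> no exponent truncates; otherwise every coefficient
      involved is 0 or 1.\<close>
    proof (cases "j < n")
      case True
      then have e: "q ^ (n - j) = q * q ^ (n - Suc j)"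
        by (metis Suc_diff_Suc power_Suc)
      have "gauss_binom q (Suc (Suc n)) (Suc k)
          = gauss_binom q (Suc n) (Suc j) + q ^ Suc k * gauss_binom q (Suc n) (Suc k)"
        using Suc by simp
      also have "\<dots> = gauss_binom q n (Suc j) + q ^ (n - j) * gauss_binom q n j
          + q ^ Suc k * (gauss_binom q n (Suc k) + q ^ (n - Suc j) * gauss_binom q n (Suc j))"
        using Suc.IH[of j] Suc.IH[of k] Suc by simp
      finally show ?thesis using Suc e by (simp add: algebra_simps)
    qed (use Suc in \<open>auto simp: gauss_binom_eq_0 not_less le_less\<close>)
  qed
qed

text \<open>The second Pascal rule splits the sum for \<open>Suc M\<close> into the sum for
  \<open>M\<close> with offset \<open>a\<close> and, after an index shift, a multiple of the one
  with offset \<open>a + 1\<close>, so the induction needs \<open>a\<close> arbitrary. The defining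
  recursion recombines the two values.\<close>

theorem q_vandermonde:
  "(\<Sum>s\<le>M. q ^ (s * (s + a)) * gauss_binom q M s * gauss_binom q N (s + a))
     = gauss_binom q (M + N) (M + a)"
proof (induction M arbitrary: a)
  case 0
  then show ?case by simp
next
  case (Suc M)
  define u where "u s = q ^ (s * (s + a)) * gauss_binom q N (s + a)" for s
  have shift: "u (Suc t) * q ^ (M - t) * gauss_binom q M t
      = q ^ (M + a + 1) * (q ^ (t * (t + Suc a)) * gauss_binom q M t * gauss_binom q N (t + Suc a))"
    if "t \<le> M" for t
  proof -
    have "Suc t * (Suc t + a) + (M - t) = (M + a + 1) + t * (t + Suc a)"
      using that by (simp add: algebra_simps)
    then have "q ^ (Suc t * (Suc t + a)) * q ^ (M - t) = q ^ (M + a + 1) * q ^ (t * (t + Suc a))"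
      by (metis power_add)
    moreover have "u (Suc t) * q ^ (M - t) * gauss_binom q M t
        = (q ^ (Suc t * (Suc t + a)) * q ^ (M - t)) * (gauss_binom q M t * gauss_binom q N (t + Suc a))"
      unfolding u_def add_Suc add_Suc_right by (simp only: mult_ac)
    ultimately show ?thesis by (simp only: mult.assoc)
  qed
  have "(\<Sum>s\<le>Suc M. q ^ (s * (s + a)) * gauss_binom q (Suc M) s * gauss_binom q N (s + a))
      = (\<Sum>s\<le>Suc M. u s * gauss_binom q (Suc M) s)"
    by (simp add: u_def mult_ac)
  also have "\<dots> = u 0 + (\<Sum>t\<le>M. u (Suc t) * gauss_binom q M (Suc t))
      + (\<Sum>t\<le>M. u (Suc t) * q ^ (M - t) * gauss_binom q M t)"
    by (subst sum.atMost_Suc_shift)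
       (simp add: gauss_binom_Suc_Suc' sum.distrib distrib_left mult.assoc del: gauss_binom.simps(3))
  also have "u 0 + (\<Sum>t\<le>M. u (Suc t) * gauss_binom q M (Suc t)) = (\<Sum>s\<le>Suc M. u s * gauss_binom q M s)"
    by (subst sum.atMost_Suc_shift) simp
  also have "\<dots> = gauss_binom q (M + N) (M + a)"
    using Suc.IH[of a] by (simp add: u_def gauss_binom_eq_0 mult_ac)
  also have "(\<Sum>t\<le>M. u (Suc t) * q ^ (M - t) * gauss_binom q M t)
      = q ^ (M + a + 1) * gauss_binom q (M + N) (M + Suc a)"
    unfolding Suc.IH[of "Suc a", symmetric] sum_distrib_left using shift by (intro sum.cong) auto
  finally show ?case by simp
qed

text \<open>Pascal's rule makes the sum telescope. This is the q-binomial theorem at the point where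
  its product has a zero factor, and it supplies the orthogonality behind inversion.\<close>

lemma gauss_binom_alternating_sum:
  assumes "n > 0"
  shows "(\<Sum>i\<le>n. (-1) ^ i * q ^ (i choose 2) * gauss_binom q n i) = 0"
proof -
  from assms obtain m where n: "n = Suc m" by (cases n) auto
  define u where "u i = (-1) ^ i * q ^ (Suc i choose 2) * gauss_binom q m i" for i
  have step: "(-1) ^ Suc i * q ^ (Suc i choose 2) * gauss_binom q n (Suc i) = u (Suc i) - u i" for i
  proof -
    have "Suc (Suc i) choose 2 = (Suc i choose 2) + Suc i"
      by (simp add: numeral_2_eq_2)
    then show ?thesis by (simp add: u_def n power_add algebra_simps)
  qed
  have "(\<Sum>i\<le>n. (-1) ^ i * q ^ (i choose 2) * gauss_binom q n i)
      = 1 + (\<Sum>i\<le>m. u (Suc i) - u i)"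
    by (subst n, subst sum.atMost_Suc_shift, simp only: step) (simp add: numeral_2_eq_2)
  also have "(\<Sum>i\<le>m. u (Suc i) - u i) = u (Suc m) - u 0"
    by (induction m) auto
  also have "\<dots> = - 1"
    by (simp add: u_def gauss_binom_eq_0 numeral_2_eq_2)
  finally show ?thesis by simp
qed

section \<open>q-factorials in the field of rational functions\<close>

lemma to_fract_power: "to_fract (x ^ n) = to_fract x ^ n"
  by (induction n) simp_all

lemma qhalf_neq_0 [simp]: "(qhalf :: 'k::field_char_0 ratfun) \<noteq> 0"
  by (simp add: qhalf_def)

text \<open>A positive power of the indeterminate has positive degree. Hence all q-factorials are
  invertible.\<close>

lemma qind_power_neq_1:
  assumes "j > 0"
  shows "(qind :: 'k::field_char_0 ratfun) ^ j \<noteq> 1"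
proof
  assume "(qind :: 'k ratfun) ^ j = 1"
  then have "to_fract ([:0, 1 :: 'k:] ^ (2 * j)) = to_fract 1"
    by (simp add: qind_def qhalf_def to_fract_power power_mult)
  then have "[:0, 1 :: 'k:] ^ (2 * j) = 1"
    by (simp only: to_fract_eq_iff)
  then have "degree ([:0, 1 :: 'k:] ^ (2 * j)) = 0" by simp
  with assms show False by (simp add: degree_power_eq)
qed

lemma qpoch_0 [simp]: "qpoch 0 = 1"
  by (simp add: qpoch_def)

lemma qpoch_Suc: "qpoch (Suc n) = qpoch n * (1 - qind ^ Suc n)"
  by (simp add: qpoch_def)

lemma qpoch_neq_0 [simp]: "qpoch n \<noteq> 0"
proof -
  have "1 - qind ^ j \<noteq> (0 :: 'a ratfun)" if "j \<in> {1..n}" for j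
    using qind_power_neq_1[of j] that by (metis atLeastAtMost_iff less_eq_Suc_le One_nat_def right_minus_eq)
  then show ?thesis
    unfolding qpoch_def by (simp only: prod_zero_iff finite_atLeastAtMost) blast
qed

text \<open>With \<open>n = Suc j + d\<close>, the two Pascal terms contribute
  \<open>qpoch n\<close> times \<open>1 - qind ^ Suc j\<close> and
  \<open>qind ^ Suc j * (1 - qind ^ Suc d)\<close>, which add up to
  \<open>1 - qind ^ Suc n\<close>.\<close>

lemma gauss_binom_mult_qpoch:
  "k \<le> n \<Longrightarrow> gauss_binom qind n k * (qpoch k * qpoch (n - k)) = qpoch n"
proof (induction n arbitrary: k)
  case 0
  then show ?case by simp
next
  case (Suc n)
  consider "k = 0" | "k = Suc n" | j where "k = Suc j" "j < n"
    using Suc.prems by (cases k) (auto simp: le_less)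
  then show ?case
  proof cases
    case 3
    then obtain d where d: "n = Suc j + d" by (metis less_iff_Suc_add add_Suc)
    let ?G = "gauss_binom qind n" and ?q = "qind :: 'a ratfun"
    have 1: "?G j * (qpoch j * qpoch (Suc d)) = (qpoch n :: 'a ratfun)"
      and 2: "?G (Suc j) * (qpoch (Suc j) * qpoch d) = (qpoch n :: 'a ratfun)"
      using Suc.IH[of j] Suc.IH[of "Suc j"] d by auto
    have "gauss_binom ?q (Suc n) k * (qpoch k * qpoch (Suc n - k))
        = (?G j * (qpoch j * qpoch (Suc d))) * (1 - ?q ^ Suc j)
          + ?q ^ Suc j * (1 - ?q ^ Suc d) * (?G (Suc j) * (qpoch (Suc j) * qpoch d))"
      using 3 d by (simp add: qpoch_Suc algebra_simps)
    also have "\<dots> = qpoch n * (1 - ?q ^ Suc j * ?q ^ Suc d)"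
      unfolding 1 2 by (simp add: algebra_simps)
    also have "?q ^ Suc j * ?q ^ Suc d = ?q ^ Suc n"
      by (simp add: d power_add)
    finally show ?thesis by (simp add: qpoch_Suc)
  qed auto
qed

lemma gauss_binom_qind:
  "k \<le> n \<Longrightarrow> gauss_binom qind n k = qpoch n / (qpoch k * qpoch (n - k))"
  using gauss_binom_mult_qpoch[of k n] by (simp add: eq_divide_eq)

lemma qbinom_of_nat: "qbinom (int n) (int k) = gauss_binom qind n k"
  by (simp add: qbinom_def gauss_binom_qind gauss_binom_eq_0 flip: of_nat_diff)

section \<open>Inversion of q-binomial transforms\<close>

text \<open>Both sides are
  \<open>qpoch n / (qpoch j * qpoch (k - j) * qpoch (n - k))\<close>.\<close>

lemma gauss_binom_trinomial_revision:
  assumes "j \<le> k" "k \<le> n"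
  shows "gauss_binom qind n k * gauss_binom qind k j
    = gauss_binom qind n j * (gauss_binom qind (n - j) (n - k) :: 'k::field_char_0 ratfun)"
  using assms by (simp add: gauss_binom_qind divide_simps)

text \<open>After the order of summation is exchanged, trinomial revision frees the inner sum of all
  but an alternating sum of order \<open>n - j\<close>, which vanishes unless
  \<open>j = n\<close>.\<close>

lemma q_binomial_inversion:
  fixes f g :: "nat \<Rightarrow> 'k::field_char_0 ratfun"
  assumes "\<And>n. f n = (\<Sum>k\<le>n. gauss_binom qind n k * g k)"
  shows "g n = (\<Sum>k\<le>n. (-1) ^ (n - k) * qind ^ ((n - k) choose 2) * gauss_binom qind n k * f k)"
proof -
  define c where "c i = (-1) ^ i * (qind :: 'k ratfun) ^ (i choose 2)" for i
  let ?G = "gauss_binom (qind :: 'k ratfun)"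
  have orth: "(\<Sum>k=j..n. c (n - k) * ?G (n - j) (n - k)) = (if j = n then 1 else 0)"
    if "j \<le> n" for j
  proof -
    have "(\<Sum>k=j..n. c (n - k) * ?G (n - j) (n - k)) = (\<Sum>i\<le>n - j. c i * ?G (n - j) i)"
      by (rule sum.reindex_bij_witness[of _ "\<lambda>i. n - i" "\<lambda>k. n - k"]) (use that in auto)
    also have "\<dots> = (if j = n then 1 else 0)"
      using gauss_binom_alternating_sum[of "n - j" "qind :: 'k ratfun"] that
      by (auto simp: c_def numeral_2_eq_2)
    finally show ?thesis .
  qed
  have "(\<Sum>k\<le>n. c (n - k) * ?G n k * f k)
      = (\<Sum>k\<le>n. \<Sum>j\<le>k. c (n - k) * ?G n k * (?G k j * g j))"
    by (simp add: assms sum_distrib_left)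
  also have "\<dots> = (\<Sum>j\<le>n. \<Sum>k=j..n. c (n - k) * ?G n k * (?G k j * g j))"
    by (simp add: sum.Sigma, rule sum.reindex_bij_witness[of _ prod.swap prod.swap]) auto
  also have "\<dots> = (\<Sum>j\<le>n. \<Sum>k=j..n. ?G n j * g j * (c (n - k) * ?G (n - j) (n - k)))"
  proof (intro sum.cong refl)
    fix j k assume "k \<in> {j..n}"
    then have "?G n k * ?G k j = ?G n j * ?G (n - j) (n - k)"
      by (intro gauss_binom_trinomial_revision) auto
    then show "c (n - k) * ?G n k * (?G k j * g j) = ?G n j * g j * (c (n - k) * ?G (n - j) (n - k))"
      by (metis (no_types, lifting) mult.assoc mult.commute)
  qed
  also have "\<dots> = (\<Sum>j\<le>n. ?G n j * g j * (if j = n then 1 else 0))"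
    by (intro sum.cong refl) (simp add: orth flip: sum_distrib_left)
  also have "\<dots> = g n" by (simp add: if_distrib cong: if_cong)
  finally show ?thesis by (simp add: c_def)
qed

section \<open>q-trinomial coefficients and the second identity\<close>

lemma qtrinom_minus: "qtrinom n L (- a) = qtrinom n L a"
proof -
  have "x / (A * B * C) = x / (B * A * C)" for A B C x :: "'a::field_char_0 ratfun"
    by (simp only: mult.commute)
  then show ?thesis
    unfolding qtrinom_def by (intro sum.cong) simp_all
qed

lemma qbinom_central_minus: "qbinom (2 * int L) (int L + a) = qbinom (2 * int L) (int L - a)"
proof -
  have "nat (2 * int L - (int L + a)) = nat (int L - a)" "nat (2 * int L - (int L - a)) = nat (int L + a)"
    by simp_all
  then show ?thesis
    by (simp add: qbinom_def mult.commute)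
qed

text \<open>Substituting \<open>r = k - a - 2 * s\<close> absorbs the parity condition and turns the
  halved integers into the naturals \<open>s\<close> and \<open>s + a\<close>.\<close>

lemma qtrinom_of_nat:
  "qtrinom n k (int a) =
     (\<Sum>s | a + 2 * s \<le> k. qhalf powi (int (k - a - 2 * s) * (int (k - a - 2 * s) - n)) * qpoch k /
        (qpoch s * qpoch (s + a) * qpoch (k - a - 2 * s)))"
  unfolding qtrinom_def
proof (rule sum.reindex_bij_witness[of _ "\<lambda>s. k - a - 2 * s" "\<lambda>r. (k - a - r) div 2"], goal_cases)
  case (1 r)
  then show ?case by (simp add: even_iff_mod_2_eq_zero) presburger
next
  case (2 r)
  then show ?case by simp presburger
next
  case (3 s)
  then show ?case by simp
next
  case (4 s)
  then show ?case by (simp add: of_nat_diff)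
next
  case (5 r)
  then have "even (k - a - r)" and le: "a + r \<le> k"
    by (simp_all add: even_iff_mod_2_eq_zero) presburger
  then obtain s where "k - a - r = 2 * s" by blast
  with le have k: "k = a + r + 2 * s" by simp
  then have "(k - a - r) div 2 = s" "k - a - 2 * s = r"
    and "(int k - int a - int r) div 2 = int s" "(int k + int a - int r) div 2 = int (s + a)"
    by simp_all
  then show ?case by (simp only: nat_int)
qed

lemma qbinom_eq_sum_qtrinom:
  "qbinom (2 * int L) (int L - int a) = (\<Sum>k\<le>L. C'_coeff L k (int a) * qtrinom 0 k (int a))"
proof -
  let ?G = "gauss_binom (qind :: 'a ratfun)"
  define t where "t k s = C'_coeff L k (int a) * (qhalf powi (int (k - a - 2 * s) * int (k - a - 2 * s)) *
    qpoch k / (qpoch s * qpoch (s + a) * qpoch (k - a - 2 * s)) :: 'a ratfun)" for k s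
  \<comment> \<open>The summand \<open>t\<close> at \<open>k = m + s + a\<close>, arranged for
    summing first over \<open>s\<close> and then over \<open>m\<close>.\<close>
  define v where "v m s = qind ^ (m * (m + a)) * ?G L m *
    (qind ^ (s * (s + a)) * ?G m s * ?G (L - m) (s + a))" for m s
  have tv: "t (m + s + a) s = v m s" if "s \<le> m" "m + s + a \<le> L" for m s
  proof -
    from that obtain r where r: "m = s + r" by (metis le_iff_add)
    with that obtain d where L: "L = s + r + s + a + d" by (metis le_iff_add)
    have "(int (m + s + a))\<^sup>2 - (int a)\<^sup>2 + int r * int r = int (2 * (m * (m + a) + s * (s + a)))"
      by (simp add: r power2_eq_square algebra_simps)
    then have pow: "qhalf powi ((int (m + s + a))\<^sup>2 - (int a)\<^sup>2) * qhalf powi (int r * int r)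
        = (qind ^ (m * (m + a)) * qind ^ (s * (s + a)) :: 'a ratfun)"
      by (simp only: power_int_add[symmetric] qhalf_neq_0 power_int_of_nat qind_def
          power_mult power_add simp_thms)
    \<comment> \<open>Both sides are
      \<open>qpoch L / (qpoch s * qpoch (s + a) * qpoch r * qpoch d)\<close>.\<close>
    have binom: "?G L (m + s + a) * (qpoch (m + s + a) / (qpoch s * qpoch (s + a) * qpoch r))
        = ?G L m * ?G m s * ?G (L - m) (s + a)"
      by (simp add: gauss_binom_qind r L divide_simps add_ac)
    have "m + s + a - a - 2 * s = r" using r by simp
    then have "t (m + s + a) s
        = (qhalf powi ((int (m + s + a))\<^sup>2 - (int a)\<^sup>2) * qhalf powi (int r * int r)) *
          (?G L (m + s + a) * (qpoch (m + s + a) / (qpoch s * qpoch (s + a) * qpoch r)))"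
      unfolding t_def C'_coeff_def qbinom_of_nat by (simp only: times_divide_eq_right mult_ac)
    also have "\<dots> = v m s"
      unfolding pow binom v_def by (simp only: mult_ac)
    finally show ?thesis .
  qed
  \<comment> \<open>This lets the range grow to the full triangle \<open>s \<le> m \<le> L\<close>
    that \<open>q_vandermonde\<close> requires.\<close>
  have v_eq_0: "v m s = 0" if "m \<le> L" "\<not> m + s + a \<le> L" for m s
  proof -
    from that have "L - m < s + a" by linarith
    then show ?thesis by (simp add: v_def gauss_binom_eq_0)
  qed
  have "(\<Sum>k\<le>L. C'_coeff L k (int a) * qtrinom 0 k (int a)) = (\<Sum>k\<le>L. \<Sum>s | a + 2 * s \<le> k. t k s)"
    by (simp add: qtrinom_of_nat t_def sum_distrib_left)
  also have "\<dots> = (\<Sum>(k, s)\<in>(SIGMA k:{..L}. {s. a + 2 * s \<le> k}). t k s)"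
    by (rule sum.Sigma) (auto intro: finite_subset[of _ "{..L}"])
  also have "\<dots> = (\<Sum>(m, s)\<in>{(m, s). s \<le> m \<and> m + s + a \<le> L}. v m s)"
    by (rule sum.reindex_bij_witness[of _ "\<lambda>(m, s). (m + s + a, s)" "\<lambda>(k, s). (k - s - a, s)"])
       (auto simp: tv[symmetric])
  also have "\<dots> = (\<Sum>(m, s)\<in>(SIGMA m:{..L}. {..m}). v m s)"
    by (rule sum.mono_neutral_left) (auto intro!: v_eq_0)
  also have "\<dots> = (\<Sum>m\<le>L. \<Sum>s\<le>m. v m s)"
    by (rule sum.Sigma[symmetric]) auto
  \<comment> \<open>\<open>q_vandermonde\<close> with upper indices \<open>m\<close> and
    \<open>L - m\<close>; the next step uses it with \<open>L\<close> and \<open>L\<close>.\<close>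
  also have "\<dots> = (\<Sum>m\<le>L. qind ^ (m * (m + a)) * ?G L m * ?G L (m + a))"
    by (intro sum.cong refl) (simp add: v_def q_vandermonde flip: sum_distrib_left)
  also have "\<dots> = qbinom (int (2 * L)) (int (L + a))"
    unfolding qbinom_of_nat by (simp add: q_vandermonde mult_2)
  also have "\<dots> = qbinom (2 * int L) (int L - int a)"
    using qbinom_central_minus[of L "int a"] by simp
  finally show ?thesis ..
qed

theorem lemma2p1:
  fixes L :: nat and a :: int
  shows "(qtrinom 0 L a :: 'k::field_char_0 ratfun) =
           (\<Sum>k=0..L. C_coeff L k a * qbinom (2 * int k) (int k - a)) \<and>
         (qbinom (2 * int L) (int L - a) :: 'k ratfun) =
           (\<Sum>k=0..L. C'_coeff L k a * qtrinom 0 k a)"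
proof
  \<comment> \<open>Needed for every \<open>n\<close>, since inversion acts on whole
    sequences.\<close>
  have second: "(qbinom (2 * int n) (int n - a) :: 'k ratfun)
      = (\<Sum>k\<le>n. C'_coeff n k a * qtrinom 0 k a)" for n
  proof (cases a rule: int_cases2)
    case (nonneg b)
    then show ?thesis by (simp add: qbinom_eq_sum_qtrinom)
  next
    case (nonpos b)
    then show ?thesis
      using qbinom_eq_sum_qtrinom[of n b]
      by (simp add: qtrinom_minus qbinom_central_minus C'_coeff_def)
  qed
  then show "(qbinom (2 * int L) (int L - a) :: 'k ratfun) = (\<Sum>k=0..L. C'_coeff L k a * qtrinom 0 k a)"
    by (simp add: atMost_atLeast0)
  let ?h = "\<lambda>i. (qhalf :: 'k ratfun) powi i"
  \<comment> \<open>\<open>C'_coeff\<close> is a q-binomial times a power depending on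
    \<open>k\<close> and one depending on \<open>a\<close>. Moving the former into \<open>g\<close>
    and the latter into \<open>f\<close> leaves a pure q-binomial transform.\<close>
  define g where "g k = ?h (int k ^ 2) * qtrinom 0 k a" for k
  define f where "f k = ?h (a ^ 2) * qbinom (2 * int k) (int k - a)" for k
  have "f n = (\<Sum>k\<le>n. gauss_binom qind n k * g k)" for n
    unfolding f_def g_def second
    by (simp add: C'_coeff_def qbinom_of_nat sum_distrib_left power_int_diff mult_ac)
  then have "g L = (\<Sum>k\<le>L. (-1) ^ (L - k) * qind ^ ((L - k) choose 2) * gauss_binom qind L k * f k)"
    by (rule q_binomial_inversion)
  then have "qtrinom 0 L a = (\<Sum>k\<le>L. (-1) ^ (L - k) * qind ^ ((L - k) choose 2) * gauss_binom qind L k * f k)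
      / ?h (int L ^ 2)"
    by (simp add: g_def field_simps)
  then show "(qtrinom 0 L a :: 'k ratfun) = (\<Sum>k=0..L. C_coeff L k a * qbinom (2 * int k) (int k - a))"
    by (simp add: f_def C_coeff_def qbinom_of_nat sum_divide_distrib power_int_diff atMost_atLeast0 mult_ac)
qed

end
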